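(* Let $E \subset \mathbb{F}_q^d$ with $|E| \leq 100^{-1}q^{d-1}$. Then $$\#\{y \in \mathbb{F}_q^d: |\pi^y(E)| \leq 10^{-1}|E|\} < 8q^{d-1}.$$
   Context: $\mathbb{F}_q$ is the finite field with $q$ elements, and $\mathbb{F}_q^d$ is the $d$-dimensional vector space over it. For a point $y\in\mathbb{F}_q^d$, the radial projection $\pi^y$ maps each point $x\neq y$ of $\mathbb{F}_q^d$ to the (affine) line containing $x$ and $y$. For $E\subset\mathbb{F}_q^d$, $\pi^y(E)=\{\pi^y(x): x\in E\setminus\{y\}\}$; thus $|\pi^y(E)|$ is the number of lines through $y$ that contain at least one point of $E\setminus\{y\}$.
   Formalization: The set E is assumed nonempty; for E empty every y satisfies |π^y(E)| = 0 ≤ |E|/10, so the count is q^d and the claimed bound fails once q ≥ 8. *)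

theory Defs
  imports "HOL-Analysis.Finite_Cartesian_Product" "HOL-Analysis.Cartesian_Space"
begin

text \<open>The space \<open>F\<^sub>q\<^sup>d\<close> is rendered as \<^typ>\<open>'a ^ 'd\<close> with \<open>'a :: {field, finite}\<close>, so that
  \<open>q = CARD('a)\<close> and \<open>d = CARD('d)\<close>. The library's \<open>affine hull\<close> is specific to real vector
  spaces, hence the explicit parametrisation of a line below.\<close>

definition line_through :: "'a::field ^ 'd \<Rightarrow> 'a ^ 'd \<Rightarrow> ('a ^ 'd) set"
  where "line_through x y = {(1 - t) *s x + t *s y | t. True}"

text \<open>This is a line only for \<open>x \<noteq> y\<close>; the value at \<open>x = y\<close> is junk.\<close>

definition radial_proj :: "'a::field ^ 'd \<Rightarrow> 'a ^ 'd \<Rightarrow> ('a ^ 'd) set"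
  where "radial_proj y x = line_through x y"

definition radial_image :: "'a::field ^ 'd \<Rightarrow> ('a ^ 'd) set \<Rightarrow> ('a ^ 'd) set set"
  where "radial_image y E = radial_proj y ` (E - {y})"

end

theory Submission
  imports Defs "HOL-Analysis.Convex"
begin

text \<open>
  Call \<open>y\<close> bad if it sees \<open>E\<close> along at most \<open>|E|/10\<close> lines, let \<open>B\<close> be the set of bad points, and
  write \<open>Q = q\<^sup>d\<^sup>-\<^sup>1\<close>. If \<open>|E| < 10\<close>, then a bad \<open>y\<close> sees \<open>E\<close> along no line at all, so \<open>E = {y}\<close>.
  Otherwise call a line rich if it has at least three points of \<open>E\<close>. The other lines that join a bad
  \<open>y\<close> to \<open>E\<close> cover at most \<open>|E|/5\<close> points, so rich lines through \<open>y\<close> cover at least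
  \<open>4/5 |E| - 1 \<ge> 7/10 |E|\<close> points of \<open>E\<close> (lemma \<open>rich_lines_cover\<close>). Summing over \<open>y\<close>, the
  incidences between \<open>B\<close> and the rich lines number at least \<open>7/10 |E| |B|\<close> when a line \<open>l\<close> is
  counted with weight \<open>|l \<inter> E|\<close>.

  This is too many. Two points determine a line, so there are few rich lines: their weights sum to
  at most \<open>|E|\<^sup>2/2 \<le> |E| Q/200\<close>, and their squared weights to at most \<open>3/2 |E|\<^sup>2\<close>. An average
  line has \<open>|B|/Q\<close> points of \<open>B\<close>, and a second moment computation (lemma \<open>line_variance\<close>)
  bounds the total squared deviation from that average, over all lines, by \<open>2 |B| Q\<close>. By
  Cauchy--Schwarz the weighted number of incidences is at most
  \<open>|E| |B|/200 + |E| sqrt (3 |B| Q)\<close> (lemma \<open>rich_incidences_le\<close>). Comparing the two bounds gives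
  \<open>|B| < 8 Q\<close>.

  All of this is double counting, and it is carried out for any finite incidence structure whose
  lines have equally many points, that number dividing the number of all points, and in which two
  points lie on exactly one line.
\<close>

section \<open>Counting in linear spaces with lines of constant size\<close>

locale uniform_linear_space =
  fixes L :: "'p::finite set set" and k Q :: nat
  assumes k_ge_2: "2 \<le> k"
    and card_line: "l \<in> L \<Longrightarrow> card l = k"
    and unique_line: "x \<noteq> y \<Longrightarrow> \<exists>!l. l \<in> L \<and> x \<in> l \<and> y \<in> l"
    and card_points: "CARD('p) = k * Q"
begin

lemma Q_pos: "0 < Q"
  using card_points by (metis gr0I mult_0_right zero_less_card_finite)

text \<open>The lines through \<open>x\<close> partition the other points.\<close>

lemma pencil_partition: "(\<Sum>l | l \<in> L \<and> x \<in> l. card (l \<inter> A - {x})) = card (A - {x})"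
proof -
  have uniq: "l = l'" if "l \<in> L" "x \<in> l" "l' \<in> L" "x \<in> l'" "z \<in> l" "z \<in> l'" "z \<noteq> x" for l l' z
    using that unique_line[of x z] by metis
  have "card (\<Union>l\<in>{l \<in> L. x \<in> l}. l \<inter> A - {x}) = (\<Sum>l | l \<in> L \<and> x \<in> l. card (l \<inter> A - {x}))"
    by (rule card_UN_disjoint) (use uniq in \<open>fastforce+\<close>)
  moreover have "(\<Union>l\<in>{l \<in> L. x \<in> l}. l \<inter> A - {x}) = A - {x}"
  proof (intro equalityI subsetI)
    fix z assume z: "z \<in> A - {x}"
    hence "x \<noteq> z" by auto
    from unique_line[OF this] obtain l where "l \<in> L" "x \<in> l" "z \<in> l" by metis
    with z show "z \<in> (\<Union>l\<in>{l \<in> L. x \<in> l}. l \<inter> A - {x})" by auto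
  qed auto
  ultimately show ?thesis by simp
qed

text \<open>The number of lines through any point, in a closed form that mentions no point.\<close>

definition r :: nat where "r = (k * Q - 1) div (k - 1)"

lemma card_pencil: "card {l \<in> L. x \<in> l} * (k - 1) = CARD('p) - 1"
proof -
  have "(\<Sum>l | l \<in> L \<and> x \<in> l. card (l \<inter> UNIV - {x})) = (\<Sum>l | l \<in> L \<and> x \<in> l. k - 1)"
    by (rule sum.cong) (auto simp: card_line)
  thus ?thesis
    using pencil_partition[of UNIV x] by (simp add: card_Diff_subset)
qed

lemma card_pencil_eq_r: "card {l \<in> L. x \<in> l} = r"
  using card_pencil[of x] k_ge_2 unfolding r_def card_points
  by (metis One_nat_def diff_is_0_eq nonzero_mult_div_cancel_right not_less_eq_eq numeral_2_eq_2)

lemma r_equation: "(real k - 1) * real r = real k * real Q - 1"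
proof -
  have "r * (k - 1) = k * Q - 1"
    using card_pencil card_pencil_eq_r card_points by metis
  hence "real (r * (k - 1)) = real (k * Q - 1)" by simp
  moreover have "1 \<le> k * Q" "1 \<le> k" using Q_pos k_ge_2 by auto
  ultimately show ?thesis by (simp add: of_nat_diff mult.commute)
qed

lemma Q_le_r: "real Q \<le> real r"
proof -
  have "1 \<le> real Q" using Q_pos by simp
  hence "(real k - 1) * real Q \<le> (real k - 1) * real r"
    unfolding r_equation by (simp add: algebra_simps)
  thus ?thesis using k_ge_2 by simp
qed

lemma r_le_2Q: "real r - 1 \<le> 2 * real Q"
proof -
  have "0 \<le> (real k - 2) * real Q" using k_ge_2 by simp
  hence "(real k - 1) * (real r - 1) \<le> (real k - 1) * (2 * real Q)"
    using k_ge_2 r_equation by (simp add: algebra_simps)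
  thus ?thesis using k_ge_2 by simp
qed

lemma sum_incidences:
  fixes w :: "'p set \<Rightarrow> real"
  shows "(\<Sum>l\<in>M. w l * real (card (l \<inter> B))) = (\<Sum>y\<in>B. \<Sum>l | l \<in> M \<and> y \<in> l. w l)"
proof -
  have "(\<Sum>l\<in>M. w l * real (card (l \<inter> B))) = (\<Sum>l\<in>M. \<Sum>y | y \<in> B \<and> y \<in> l. w l)"
    by (rule sum.cong) (auto simp: Int_def conj_commute)
  also have "\<dots> = (\<Sum>y\<in>B. \<Sum>l | l \<in> M \<and> y \<in> l. w l)"
    by (rule sum.swap_restrict) auto
  finally show ?thesis .
qed

lemma sum_card_inter: "(\<Sum>l\<in>L. real (card (l \<inter> B))) = real (card B) * real r"
  using sum_incidences[of "\<lambda>_. 1" B L] card_pencil_eq_r by simp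

lemma card_lines: "real (card L) = real Q * real r"
proof -
  have "real k * real (card L) = real k * (real Q * real r)"
    using sum_card_inter[of UNIV] by (simp add: card_line card_points mult_ac)
  thus ?thesis using k_ge_2 by simp
qed

text \<open>Both sides count the ordered pairs of distinct points of \<open>B\<close>: each pair lies on one line.\<close>

lemma sum_card_pairs:
  "(\<Sum>l\<in>L. real (card (l \<inter> B)) * (real (card (l \<inter> B)) - 1)) = real (card B) * (real (card B) - 1)"
proof -
  have diff: "real (card (A - {x})) = real (card A) - 1" if "x \<in> A" for x and A :: "'p set"
    using that by (metis card_Suc_Diff1 finite of_nat_Suc add_diff_cancel_left')
  have "(\<Sum>l\<in>L. real (card (l \<inter> B)) * (real (card (l \<inter> B)) - 1))
      = (\<Sum>l\<in>L. (real (card (l \<inter> B)) - 1) * real (card (l \<inter> B)))"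
    by (simp add: mult.commute)
  also have "\<dots> = (\<Sum>y\<in>B. \<Sum>l | l \<in> L \<and> y \<in> l. real (card (l \<inter> B)) - 1)"
    by (rule sum_incidences)
  also have "\<dots> = (\<Sum>y\<in>B. \<Sum>l | l \<in> L \<and> y \<in> l. real (card (l \<inter> B - {y})))"
    by (intro sum.cong refl diff[symmetric]) auto
  also have "\<dots> = (\<Sum>y\<in>B. real (card B) - 1)"
    unfolding of_nat_sum[symmetric] pencil_partition unfolding of_nat_sum
    by (intro sum.cong refl diff)
  finally show ?thesis by simp
qed

text \<open>The pairs of distinct points of \<open>B\<close> contribute about \<open>|B|\<^sup>2\<close> to the second moment of
  \<open>|l \<inter> B|\<close>. Since \<open>Q \<le> r\<close>, passing to deviations from the average \<open>|B|/Q\<close> removes at least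
  \<open>|B|\<^sup>2\<close>, and what is left is linear in \<open>|B|\<close>. So \<open>B\<close> meets most lines in close to the average
  number of points.\<close>

lemma line_variance:
  "(\<Sum>l\<in>L. (real (card (l \<inter> B)) - real (card B) / real Q)\<^sup>2) \<le> 2 * real (card B) * real Q"
proof -
  define b where "b = real (card B)"
  define m where "m = b / real Q"
  have mQ: "m * real Q = b" using Q_pos by (simp add: m_def)
  have "(\<Sum>l\<in>L. (real (card (l \<inter> B)) - m)\<^sup>2)
     = (\<Sum>l\<in>L. real (card (l \<inter> B)) * (real (card (l \<inter> B)) - 1)
         + (1 - 2 * m) * real (card (l \<inter> B)) + m\<^sup>2)"
    by (intro sum.cong refl) (simp add: power2_eq_square algebra_simps)
  also have "\<dots> = b * (b - 1) + (1 - 2 * m) * (b * real r) + real (card L) * m\<^sup>2"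
    unfolding sum.distrib sum_card_pairs sum_distrib_left[symmetric] sum_card_inter b_def by simp
  also have "\<dots> = b * (b - 1) + b * real r - 2 * m * b * real r + (m * real Q) * m * real r"
    by (simp add: card_lines power2_eq_square algebra_simps)
  also have "\<dots> = b * (real r - 1) + b * m * (real Q - real r)"
    unfolding mQ by (simp add: algebra_simps flip: mQ)
  also have "\<dots> \<le> b * (2 * real Q) + 0"
    by (intro add_mono mult_left_mono mult_nonneg_nonpos)
      (use Q_le_r r_le_2Q in \<open>auto simp: b_def m_def\<close>)
  finally show ?thesis by (simp add: b_def m_def mult_ac)
qed

section \<open>Points that see a small set along few lines\<close>

definition rich_lines :: "'p set \<Rightarrow> 'p set set" where
  "rich_lines E = {l \<in> L. 3 \<le> card (l \<inter> E)}"

lemma sum_rich_pairs: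
  "(\<Sum>l\<in>rich_lines E. real (card (l \<inter> E)) * (real (card (l \<inter> E)) - 1)) \<le> (real (card E))\<^sup>2"
proof -
  have nonneg: "0 \<le> real n * (real n - 1)" for n :: nat by (cases n) auto
  have "(\<Sum>l\<in>rich_lines E. real (card (l \<inter> E)) * (real (card (l \<inter> E)) - 1))
      \<le> (\<Sum>l\<in>L. real (card (l \<inter> E)) * (real (card (l \<inter> E)) - 1))"
    by (rule sum_mono2) (auto simp: rich_lines_def nonneg)
  also have "\<dots> \<le> (real (card E))\<^sup>2"
    unfolding sum_card_pairs by (simp add: power2_eq_square algebra_simps)
  finally show ?thesis .
qed

lemma sum_rich_weights: "(\<Sum>l\<in>rich_lines E. real (card (l \<inter> E))) \<le> (real (card E))\<^sup>2 / 2"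
proof -
  have "(\<Sum>l\<in>rich_lines E. 2 * real (card (l \<inter> E)))
      \<le> (\<Sum>l\<in>rich_lines E. real (card (l \<inter> E)) * (real (card (l \<inter> E)) - 1))"
  proof (rule sum_mono)
    fix l assume "l \<in> rich_lines E"
    hence "3 \<le> real (card (l \<inter> E))" by (simp add: rich_lines_def)
    hence "real (card (l \<inter> E)) * 2 \<le> real (card (l \<inter> E)) * (real (card (l \<inter> E)) - 1)"
      by (intro mult_left_mono) auto
    thus "2 * real (card (l \<inter> E)) \<le> real (card (l \<inter> E)) * (real (card (l \<inter> E)) - 1)"
      by simp
  qed
  thus ?thesis using sum_rich_pairs[of E] by (simp flip: sum_distrib_left)
qed

lemma sum_rich_squares: "(\<Sum>l\<in>rich_lines E. (real (card (l \<inter> E)))\<^sup>2) \<le> 3 / 2 * (real (card E))\<^sup>2"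
proof -
  have "(\<Sum>l\<in>rich_lines E. (real (card (l \<inter> E)))\<^sup>2)
      = (\<Sum>l\<in>rich_lines E. real (card (l \<inter> E)) * (real (card (l \<inter> E)) - 1))
        + (\<Sum>l\<in>rich_lines E. real (card (l \<inter> E)))"
    by (simp add: power2_eq_square algebra_simps flip: sum.distrib)
  thus ?thesis using sum_rich_pairs[of E] sum_rich_weights[of E] by simp
qed

text \<open>Every line through \<open>y\<close> that meets \<open>E - {y}\<close> and is not rich accounts for at most two
  points. The lines through \<open>y\<close> cover \<open>E - {y}\<close>, whence the \<open>- 1\<close>.\<close>

lemma rich_lines_cover:
  "real (card E) - 1 \<le> 2 * real (card {l \<in> L. y \<in> l \<and> l \<inter> E - {y} \<noteq> {}})
     + (\<Sum>l | l \<in> rich_lines E \<and> y \<in> l. real (card (l \<inter> E)))"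
proof -
  let ?P = "{l \<in> L. y \<in> l}" and ?w = "\<lambda>l. real (card (l \<inter> E))"
  have "real (card E) - 1 \<le> real (card (E - {y}))"
    using diff_card_le_card_Diff[of "{y}" E] by simp
  also have "\<dots> = (\<Sum>l\<in>?P. real (card (l \<inter> E - {y})))"
    unfolding of_nat_sum[symmetric] pencil_partition ..
  also have "\<dots> \<le> (\<Sum>l\<in>?P. 2 * of_bool (l \<inter> E - {y} \<noteq> {}) + of_bool (l \<in> rich_lines E) * ?w l)"
  proof (rule sum_mono)
    fix l assume "l \<in> ?P"
    have "card (l \<inter> E - {y}) \<le> card (l \<inter> E)" by (rule card_mono) auto
    with \<open>l \<in> ?P\<close> have "real (card (l \<inter> E - {y})) \<le> 2 + of_bool (l \<in> rich_lines E) * ?w l"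
      by (auto simp: rich_lines_def)
    thus "real (card (l \<inter> E - {y}))
        \<le> 2 * of_bool (l \<inter> E - {y} \<noteq> {}) + of_bool (l \<in> rich_lines E) * ?w l"
    proof (cases "l \<inter> E - {y} = {}")
      case True
      show ?thesis unfolding True by simp
    qed simp
  qed
  also have "\<dots> = 2 * real (card (?P \<inter> {l. l \<inter> E - {y} \<noteq> {}})) + (\<Sum>l\<in>?P \<inter> rich_lines E. ?w l)"
    by (simp add: sum.distrib sum_of_bool_mult_eq flip: sum_distrib_left)
  also have "?P \<inter> {l. l \<inter> E - {y} \<noteq> {}} = {l \<in> L. y \<in> l \<and> l \<inter> E - {y} \<noteq> {}}" by auto
  also have "?P \<inter> rich_lines E = {l. l \<in> rich_lines E \<and> y \<in> l}" by (auto simp: rich_lines_def)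
  finally show ?thesis .
qed

text \<open>The first term is what the rich lines would contribute if each had the average number
  \<open>|B|/Q\<close> of points of \<open>B\<close>; the second bounds the deviation from that by Cauchy--Schwarz.\<close>

lemma rich_incidences_le:
  "(\<Sum>l\<in>rich_lines E. real (card (l \<inter> E)) * real (card (l \<inter> B)))
     \<le> real (card B) / real Q * ((real (card E))\<^sup>2 / 2)
       + real (card E) * sqrt (3 * real (card B) * real Q)"
proof -
  let ?w = "\<lambda>l. real (card (l \<inter> E))" and ?m = "real (card B) / real Q"
  let ?D = "\<Sum>l\<in>rich_lines E. ?w l * (real (card (l \<inter> B)) - ?m)"
  have "?D\<^sup>2 \<le> (\<Sum>l\<in>rich_lines E. (?w l)\<^sup>2) * (\<Sum>l\<in>rich_lines E. (real (card (l \<inter> B)) - ?m)\<^sup>2)"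
    by (rule Cauchy_Schwarz_ineq_sum)
  also have "\<dots> \<le> (3 / 2 * (real (card E))\<^sup>2) * (2 * real (card B) * real Q)"
  proof (rule mult_mono[OF sum_rich_squares])
    have "(\<Sum>l\<in>rich_lines E. (real (card (l \<inter> B)) - ?m)\<^sup>2) \<le> (\<Sum>l\<in>L. (real (card (l \<inter> B)) - ?m)\<^sup>2)"
      by (rule sum_mono2) (auto simp: rich_lines_def)
    also note line_variance
    finally show "(\<Sum>l\<in>rich_lines E. (real (card (l \<inter> B)) - ?m)\<^sup>2) \<le> 2 * real (card B) * real Q" .
  qed (auto intro: sum_nonneg)
  finally have "?D \<le> sqrt ((real (card E))\<^sup>2 * (3 * real (card B) * real Q))"
    by (intro real_le_rsqrt) (simp add: mult_ac)
  hence D: "?D \<le> real (card E) * sqrt (3 * real (card B) * real Q)"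
    by (simp add: real_sqrt_mult)
  have "(\<Sum>l\<in>rich_lines E. ?w l * real (card (l \<inter> B))) = ?m * (\<Sum>l\<in>rich_lines E. ?w l) + ?D"
    by (simp add: sum_distrib_left algebra_simps flip: sum.distrib)
  also have "\<dots> \<le> ?m * ((real (card E))\<^sup>2 / 2) + real (card E) * sqrt (3 * real (card B) * real Q)"
    by (intro add_mono mult_left_mono sum_rich_weights D) auto
  finally show ?thesis .
qed

text \<open>The two estimates of the weighted incidences compare to \<open>139/200 |B| \<le> sqrt (3 |B| Q)\<close>, and
  \<open>3 (200/139)\<^sup>2 < 8\<close>.\<close>

theorem few_bad_points:
  assumes "E \<noteq> {}" and small: "real (card E) \<le> real Q / 100"
    and bad: "\<And>y. y \<in> B \<Longrightarrow> real (card {l \<in> L. y \<in> l \<and> l \<inter> E - {y} \<noteq> {}}) \<le> real (card E) / 10"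
  shows "real (card B) < 8 * real Q"
proof (cases "10 \<le> card E")
  case False
  \<comment> \<open>Fewer than one line through \<open>y\<close> meets \<open>E - {y}\<close>, so \<open>E = {y}\<close>.\<close>
  have "B \<subseteq> E"
  proof
    fix y assume "y \<in> B"
    from bad[OF this] False have "card {l \<in> L. y \<in> l \<and> l \<inter> E - {y} \<noteq> {}} = 0" by linarith
    hence "{l \<in> L. y \<in> l \<and> l \<inter> E - {y} \<noteq> {}} = {}" by simp
    hence "(\<Sum>l | l \<in> L \<and> y \<in> l. card (l \<inter> E - {y})) = 0" by (auto simp del: Diff_eq_empty_iff)
    hence "E - {y} = {}" using pencil_partition[of E y] by simp
    with \<open>E \<noteq> {}\<close> show "y \<in> E" by blast
  qed
  hence "real (card B) \<le> real (card E)" by (simp add: card_mono)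
  thus ?thesis using small Q_pos by simp
next
  case True
  define n b where "n = real (card E)" and "b = real (card B)"
  have n: "10 \<le> n" and b: "0 \<le> b" using True by (auto simp: n_def b_def)
  have "b * (7 / 10 * n) = (\<Sum>y\<in>B. 7 / 10 * n)" by (simp add: b_def)
  also have "\<dots> \<le> (\<Sum>y\<in>B. \<Sum>l | l \<in> rich_lines E \<and> y \<in> l. real (card (l \<inter> E)))"
  proof (rule sum_mono)
    fix y assume "y \<in> B"
    from bad[OF this] rich_lines_cover[of E y] n
    show "7 / 10 * n \<le> (\<Sum>l | l \<in> rich_lines E \<and> y \<in> l. real (card (l \<inter> E)))"
      unfolding n_def by linarith
  qed
  also have "\<dots> = (\<Sum>l\<in>rich_lines E. real (card (l \<inter> E)) * real (card (l \<inter> B)))"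
    by (rule sum_incidences[symmetric])
  also have "\<dots> \<le> b / real Q * (n\<^sup>2 / 2) + n * sqrt (3 * b * real Q)"
    unfolding n_def b_def by (rule rich_incidences_le)
  also have "b / real Q * (n\<^sup>2 / 2) \<le> b * n / 200"
  proof -
    have "b * n * n \<le> b * n * (real Q / 100)"
      using small n b by (intro mult_left_mono) (auto simp: n_def)
    thus ?thesis using Q_pos by (simp add: field_simps power2_eq_square)
  qed
  \<comment> \<open>\<open>139/200 = 7/10 - 1/200\<close>\<close>
  finally have "n * (139 / 200 * b) \<le> n * sqrt (3 * b * real Q)" by (simp add: algebra_simps)
  hence "139 / 200 * b \<le> sqrt (3 * b * real Q)" using n by simp
  hence "(139 / 200 * b)\<^sup>2 \<le> (sqrt (3 * b * real Q))\<^sup>2"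
    using b by (intro power_mono) auto
  hence *: "b * ((139 / 200)\<^sup>2 * b) \<le> b * (3 * real Q)"
    using b by (simp add: power2_eq_square mult_ac)
  show ?thesis
  proof (cases "b = 0")
    case False
    with * b have "(139 / 200)\<^sup>2 * b \<le> 3 * real Q" by simp
    moreover have "0 < real Q" using Q_pos by simp
    ultimately show ?thesis unfolding b_def[symmetric] power2_eq_square by linarith
  qed (use Q_pos in \<open>simp add: b_def\<close>)
qed

end

section \<open>Lines in a vector space over a finite field\<close>

lemma line_through_eq_range: "line_through x y = range (\<lambda>t. x + t *s (y - x))"
proof -
  have "(1 - t) *s x + t *s y = x + t *s (y - x)" for t
    by (simp add: vec_eq_iff algebra_simps)
  thus ?thesis unfolding line_through_def by auto
qed

lemma endpoints_in_line_through: "x \<in> line_through x y" "y \<in> line_through x y"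
proof -
  have "x = x + 0 *s (y - x)" "y = x + 1 *s (y - x)" by auto
  thus "x \<in> line_through x y" "y \<in> line_through x y"
    unfolding line_through_eq_range by blast+
qed

lemma card_line_through:
  fixes x y :: "'a::{field,finite} ^ 'd"
  assumes "x \<noteq> y"
  shows "card (line_through x y) = CARD('a)"
proof -
  obtain i where "x $ i \<noteq> y $ i" using assms by (auto simp: vec_eq_iff)
  hence "inj (\<lambda>t. x + t *s (y - x))" by (auto simp: inj_def vec_eq_iff)
  thus ?thesis unfolding line_through_eq_range by (simp add: card_image)
qed

text \<open>If \<open>a\<close> and \<open>b\<close> have parameters \<open>s\<close> and \<open>t\<close> on the line through \<open>x\<close> and \<open>y\<close>, then
  \<open>u \<mapsto> s + u (t - s)\<close> is an affine bijection of the parameter field when \<open>s \<noteq> t\<close>.\<close>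

lemma line_through_eq:
  assumes "a \<in> line_through x y" "b \<in> line_through x y" "a \<noteq> b"
  shows "line_through a b = line_through x y"
proof -
  obtain s t where a: "a = x + s *s (y - x)" and b: "b = x + t *s (y - x)"
    using assms unfolding line_through_eq_range by blast
  have "s \<noteq> t" using assms(3) a b by auto
  have reparam: "a + u *s (b - a) = x + (s + u * (t - s)) *s (y - x)" for u
    unfolding a b by (simp add: vec_eq_iff algebra_simps)
  have "range (\<lambda>u. s + u * (t - s)) = UNIV"
  proof (rule surjI)
    show "s + (v - s) / (t - s) * (t - s) = v" for v using \<open>s \<noteq> t\<close> by simp
  qed
  hence "range (\<lambda>u. x + (s + u * (t - s)) *s (y - x)) = range (\<lambda>v. x + v *s (y - x))"
    using image_image[of "\<lambda>v. x + v *s (y - x)" "\<lambda>u. s + u * (t - s)" UNIV] by simp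
  thus ?thesis unfolding line_through_eq_range reparam .
qed

definition affine_lines :: "('a::field ^ 'd) set set" where
  "affine_lines = {line_through x y | x y. x \<noteq> y}"

lemma affine_lines_linear_space:
  "uniform_linear_space (affine_lines :: ('a::{field,finite} ^ 'd::finite) set set)
     CARD('a) (CARD('a) ^ (CARD('d) - 1))"
proof
  have "card {0 :: 'a, 1} \<le> CARD('a)" by (rule card_mono) auto
  thus "2 \<le> CARD('a)" by simp
  show "card l = CARD('a)" if "l \<in> affine_lines" for l :: "('a ^ 'd) set"
    using that card_line_through by (auto simp: affine_lines_def)
  show "\<exists>!l. l \<in> affine_lines \<and> x \<in> l \<and> y \<in> l" if "x \<noteq> y" for x y :: "'a ^ 'd"
  proof (rule ex1I)
    show "line_through x y \<in> affine_lines \<and> x \<in> line_through x y \<and> y \<in> line_through x y"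
      using that endpoints_in_line_through by (auto simp: affine_lines_def)
    show "l = line_through x y" if "l \<in> affine_lines \<and> x \<in> l \<and> y \<in> l" for l
      using that line_through_eq[OF _ _ \<open>x \<noteq> y\<close>] by (auto simp: affine_lines_def)
  qed
  show "CARD('a ^ 'd) = CARD('a) * CARD('a) ^ (CARD('d) - 1)"
    by (simp add: power_eq_if)
qed

lemma radial_image_eq:
  "radial_image y E = {l \<in> affine_lines. y \<in> l \<and> l \<inter> E - {y} \<noteq> {}}"
proof (intro set_eqI iffI)
  fix l assume "l \<in> radial_image y E"
  then obtain x where "x \<in> E" "x \<noteq> y" "l = line_through x y"
    by (auto simp: radial_image_def radial_proj_def)
  thus "l \<in> {l \<in> affine_lines. y \<in> l \<and> l \<inter> E - {y} \<noteq> {}}"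
    using endpoints_in_line_through by (fastforce simp: affine_lines_def)
next
  fix l assume "l \<in> {l \<in> affine_lines. y \<in> l \<and> l \<inter> E - {y} \<noteq> {}}"
  then obtain x where "l \<in> affine_lines" "y \<in> l" "x \<in> l" "x \<in> E" "x \<noteq> y" by blast
  hence "l = line_through x y"
    using line_through_eq[OF _ _ \<open>x \<noteq> y\<close>] by (auto simp: affine_lines_def)
  thus "l \<in> radial_image y E"
    using \<open>x \<in> E\<close> \<open>x \<noteq> y\<close> by (auto simp: radial_image_def radial_proj_def)
qed

theorem theorem1p4:
  fixes E :: "('a::{field,finite} ^ 'd::finite) set"
  assumes "E \<noteq> {}"
    and "real (card E) \<le> (1 / 100) * real CARD('a) ^ (CARD('d) - 1)"
  shows "real (card {y :: 'a ^ 'd. real (card (radial_image y E)) \<le> (1 / 10) * real (card E)})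
           < 8 * real CARD('a) ^ (CARD('d) - 1)"
proof -
  interpret uniform_linear_space "affine_lines :: ('a ^ 'd) set set"
    "CARD('a)" "CARD('a) ^ (CARD('d) - 1)"
    by (rule affine_lines_linear_space)
  show ?thesis
    using few_bad_points[of E "{y. real (card (radial_image y E)) \<le> (1 / 10) * real (card E)}"]
      assms by (simp add: radial_image_eq)
qed

end
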